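(* Let $\varepsilon>0$ be such that $e^{\varepsilon}$ is transcendental, and let $$\pi_{2n}=\mathbb{P}[x^\varepsilon_{2n}=e]=\mathbb{P}\Big[S_{2n}=0,\ \sum_{k=1}^{2n}Y_k e^{\varepsilon S_{k-1}}=0\Big]$$ be the return probability of the Bernoulli random walk $(x^\varepsilon_n)_{n\ge0}$ on $\mathrm{Aff}(\mathbb{R})$. Then there exists $c\ge1$ such that for all $n$ large enough, $$\pi_{2n}\le\exp\big(-c^{-1}n^{1/3}\ln(n)^{2/3}\big).$$
   Context: $\mathrm{Aff}(\mathbb{R})$ is the group of matrices $\begin{pmatrix} a& b\\ 0&1\end{pmatrix}$ with $a>0$, $b\in\mathbb{R}$, and $e$ is the identity matrix. Let $(X_i)_{i\ge1}$ and $(Y_i)_{i\ge1}$ be independent sequences of independent random variables with $\mathbb{P}[X_i=\pm1]=\mathbb{P}[Y_i=\pm1]=\frac12$. Put $S_0=0$, $S_n=\sum_{i=1}^nX_i$. The random walk is defined by $x_0^\varepsilon=e$ and $x^\varepsilon_{n+1}=x^\varepsilon_n\begin{pmatrix} e^{\varepsilon X_{n+1}}&\varepsilon Y_{n+1}\\0&1\end{pmatrix}$, so that $$x_n^\varepsilon=\begin{pmatrix} e^{\varepsilon S_n}&\varepsilon\sum_{i=1}^nY_ie^{\varepsilon S_{i-1}}\\0&1\end{pmatrix}.$$ *)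

theory Defs
  imports "HOL-Probability.Probability" "HOL-Computational_Algebra.Polynomial"
begin

definition aff_mat :: "real \<Rightarrow> real \<Rightarrow> real^2^2" where
  "aff_mat a b = vector [vector [a, b], vector [0, 1]]"

definition Aff :: "(real^2^2) set" where
  "Aff = {aff_mat a b | a b. a > 0}"

text \<open>The index 0 of the step sequences \<open>X\<close> and \<open>Y\<close> is never used: steps are numbered from 1.\<close>

definition walk_S :: "(nat \<Rightarrow> 'w \<Rightarrow> real) \<Rightarrow> nat \<Rightarrow> 'w \<Rightarrow> real" where
  "walk_S X n \<omega> = (\<Sum>i = 1..n. X i \<omega>)"

primrec aff_walk ::
  "real \<Rightarrow> (nat \<Rightarrow> 'w \<Rightarrow> real) \<Rightarrow> (nat \<Rightarrow> 'w \<Rightarrow> real) \<Rightarrow> nat \<Rightarrow> 'w \<Rightarrow> real^2^2" where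
  "aff_walk \<epsilon> X Y 0 \<omega> = mat 1"
| "aff_walk \<epsilon> X Y (Suc n) \<omega> =
     aff_walk \<epsilon> X Y n \<omega> ** aff_mat (exp (\<epsilon> * X (Suc n) \<omega>)) (\<epsilon> * Y (Suc n) \<omega>)"

definition return_prob ::
  "'w measure \<Rightarrow> real \<Rightarrow> (nat \<Rightarrow> 'w \<Rightarrow> real) \<Rightarrow> (nat \<Rightarrow> 'w \<Rightarrow> real) \<Rightarrow> nat \<Rightarrow> real" where
  "return_prob M \<epsilon> X Y n = measure M {\<omega> \<in> space M. aff_walk \<epsilon> X Y n \<omega> = mat 1}"

text \<open>
  The two sequences are mutually independent and each consists of independent variables, i.e. the
  joint family indexed by the disjoint sum of two copies of \<open>{1..}\<close> is independent; \<open>indep_vars\<close>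
  includes measurability. The values 1 and -1 are only required almost surely.
\<close>

definition bernoulli_steps ::
  "'w measure \<Rightarrow> (nat \<Rightarrow> 'w \<Rightarrow> real) \<Rightarrow> (nat \<Rightarrow> 'w \<Rightarrow> real) \<Rightarrow> bool" where
  "bernoulli_steps M X Y \<longleftrightarrow>
     prob_space.indep_vars M (\<lambda>_. borel) (case_sum X Y) ({1..} <+> {1..}) \<and>
     (\<forall>i\<ge>1. measure M {\<omega> \<in> space M. X i \<omega> = 1} = 1/2 \<and> measure M {\<omega> \<in> space M. X i \<omega> = -1} = 1/2 \<and>
            measure M {\<omega> \<in> space M. Y i \<omega> = 1} = 1/2 \<and> measure M {\<omega> \<in> space M. Y i \<omega> = -1} = 1/2)"

lemma aff_mat_1_0: "aff_mat 1 0 = mat 1"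
  by (simp add: aff_mat_def vec_eq_iff forall_2 mat_def)

lemma aff_mat_mult: "aff_mat a b ** aff_mat a' b' = aff_mat (a * a') (a * b' + b)"
  by (simp add: aff_mat_def vec_eq_iff forall_2 matrix_matrix_mult_def sum_2)

lemma aff_mat_inject: "aff_mat a b = aff_mat a' b' \<longleftrightarrow> a = a' \<and> b = b'"
  by (auto simp: aff_mat_def vec_eq_iff forall_2)

lemma aff_walk_explicit:
  "aff_walk \<epsilon> X Y n \<omega> =
     aff_mat (exp (\<epsilon> * walk_S X n \<omega>)) (\<epsilon> * (\<Sum>i = 1..n. Y i \<omega> * exp (\<epsilon> * walk_S X (i - 1) \<omega>)))"
proof (induction n)
  case 0
  then show ?case by (simp add: walk_S_def aff_mat_1_0)
next
  case (Suc n)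
  then show ?case
    by (simp add: aff_mat_mult aff_mat_inject walk_S_def exp_add algebra_simps)
qed

lemma aff_walk_in_Aff: "aff_walk \<epsilon> X Y n \<omega> \<in> Aff"
  unfolding aff_walk_explicit Aff_def using exp_gt_zero by blast

end

theory Submission imports Defs "HOL-Real_Asymp.Real_Asymp" begin

text \<open>Condition on the first coordinate walk \<open>S\<close>. Grouping the sum \<open>\<Sum>k. Y k * exp \<epsilon> powi S (k - 1)\<close> by the
value of the exponent turns it into a Laurent polynomial in \<open>exp \<epsilon>\<close> with integer coefficients; since
\<open>exp \<epsilon>\<close> is transcendental, the sum vanishes only if, at every site \<open>j\<close>, the signs drawn during the
visits to \<open>j\<close> cancel. These events are independent over the sites, and the one at \<open>j\<close> has the
probability that a simple walk returns to 0 at time \<open>L j\<close>, the number of visits to \<open>j\<close>, which is at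
most \<open>1 / sqrt (L j + 1)\<close> (\<open>hit0_origin_le\<close>). Hence \<open>h\<close> sites with at least \<open>m\<close> visits each together cost
a factor \<open>(m + 1) powr (- h / 2)\<close> (\<open>cancel_prob_le\<close>).

It remains to see that few heavily visited sites are unlikely. Cut time into blocks of length \<open>u\<^sup>2\<close>.
Within one block the walk typically stays at distance of order \<open>u\<close> from its starting point, and its
number of self-intersections has expectation at most \<open>4 u\<^sup>3\<close>; so the visits cannot concentrate on much fewer
than \<open>u\<close> sites, and with probability at least 3/4 a number of sites proportional to \<open>u\<close> is visited a
number of times proportional to \<open>u\<close> (\<open>block_few_heavy_prob\<close>). A site that is heavy for one block is
heavy for the whole walk, and the blocks are independent, so having few heavy sites after \<open>N\<close> steps
has probability at most \<open>(1 / 4) ^ (N div u\<^sup>2)\<close> (\<open>few_heavy_prob\<close>).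

Altogether the return probability at time \<open>2 n\<close> is at most
\<open>exp (- c n / u\<^sup>2) + exp (- c' u ln u)\<close>, for constants \<open>c\<close> and \<open>c'\<close> and large \<open>u\<close> and \<open>n / u\<^sup>2\<close>. Both
exponents have the order \<open>n powr (1/3) * ln n powr (2/3)\<close> when \<open>u\<close> is about
\<open>(n / ln n) powr (1/3)\<close> (\<open>block_length_tradeoff\<close>).\<close>

section \<open>Expectation over fair sign sequences\<close>

text \<open>The expectation of \<open>f\<close> over \<open>n\<close> independent fair signs. The recursion on the first sign is the Markov
property of the walk, and makes induction over the time of the walk immediate.\<close>

primrec sign_avg :: "nat \<Rightarrow> (int list \<Rightarrow> real) \<Rightarrow> real" where
  "sign_avg 0 f = f []"
| "sign_avg (Suc n) f = (sign_avg n (\<lambda>xs. f (1 # xs)) + sign_avg n (\<lambda>xs. f (-1 # xs))) / 2"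

lemma sign_avg_mono:
  assumes "\<And>xs. length xs = n \<Longrightarrow> set xs \<subseteq> {1, -1} \<Longrightarrow> f xs \<le> g xs"
  shows "sign_avg n f \<le> sign_avg n g"
  using assms
proof (induction n arbitrary: f g)
  case (Suc n)
  have "sign_avg n (\<lambda>xs. f (1 # xs)) \<le> sign_avg n (\<lambda>xs. g (1 # xs))"
       "sign_avg n (\<lambda>xs. f (-1 # xs)) \<le> sign_avg n (\<lambda>xs. g (-1 # xs))"
    by (intro Suc.IH Suc.prems; simp)+
  then show ?case by simp
qed simp

lemma sign_avg_add: "sign_avg n (\<lambda>xs. f xs + g xs) = sign_avg n f + sign_avg n g"
  by (induction n arbitrary: f g) (simp_all add: field_simps)

lemma sign_avg_mult: "sign_avg n (\<lambda>xs. c * f xs) = c * sign_avg n f"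
  by (induction n arbitrary: f) (simp_all add: field_simps)

lemma sign_avg_const: "sign_avg n (\<lambda>_. c) = c"
  by (induction n) simp_all

lemma sign_avg_append:
  "sign_avg (m + n) f = sign_avg m (\<lambda>xs. sign_avg n (\<lambda>ys. f (xs @ ys)))"
  by (induction m arbitrary: f) simp_all

definition signs :: "nat \<Rightarrow> int list set" where
  "signs n = {xs. set xs \<subseteq> {1, -1} \<and> length xs = n}"

lemma finite_signs: "finite (signs n)"
  unfolding signs_def by (rule finite_lists_length_eq) simp

lemma signs_Suc: "signs (Suc n) = (#) 1 ` signs n \<union> (#) (-1) ` signs n"
proof -
  have "xs \<in> (#) 1 ` signs n \<union> (#) (-1) ` signs n" if "xs \<in> signs (Suc n)" for xs
    using that by (cases xs) (auto simp: signs_def)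
  then show ?thesis by (auto simp: signs_def)
qed

lemma sign_avg_eq_sum: "sign_avg n f = (\<Sum>xs\<in>signs n. f xs) / 2 ^ n"
proof (induction n arbitrary: f)
  case 0
  have "signs 0 = {[]}" by (auto simp: signs_def)
  then show ?case by simp
next
  case (Suc n)
  have "(\<Sum>xs\<in>signs (Suc n). f xs) =
      (\<Sum>xs\<in>(#) 1 ` signs n. f xs) + (\<Sum>xs\<in>(#) (-1) ` signs n. f xs)"
    unfolding signs_Suc by (rule sum.union_disjoint) (auto simp: finite_signs)
  then show ?case by (simp add: Suc sum.reindex add_divide_distrib)
qed

section \<open>Return probabilities of the simple walk\<close>

text \<open>The probability that the simple walk started at \<open>a\<close> is at 0 after \<open>m\<close> steps.\<close>

primrec hit0 :: "nat \<Rightarrow> int \<Rightarrow> real" where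
  "hit0 0 a = of_bool (a = 0)"
| "hit0 (Suc m) a = (hit0 m (a + 1) + hit0 m (a - 1)) / 2"

lemma hit0_nonneg: "0 \<le> hit0 m a"
  by (induction m arbitrary: a) simp_all

lemma hit0_eq_0: "a < - int m \<or> odd (int m + a) \<Longrightarrow> hit0 m a = 0"
  by (induction m arbitrary: a) auto

text \<open>The walk started at \<open>2 k - m\<close> ends at 0 exactly when \<open>k\<close> of its \<open>m\<close> steps are downward.\<close>

lemma hit0_binomial: "hit0 m (2 * int k - int m) = real (m choose k) / 2 ^ m"
proof (induction m arbitrary: k)
  case 0
  then show ?case by (cases k) auto
next
  case (Suc m)
  have 1: "hit0 m (2 * int k - int (Suc m) + 1) = real (m choose k) / 2 ^ m"
    using Suc[of k] by simp
  show ?case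
  proof (cases k)
    case 0
    then show ?thesis using 1 by (simp add: hit0_eq_0)
  next
    case (Suc l)
    have "hit0 m (2 * int k - int (Suc m) - 1) = real (m choose l) / 2 ^ m"
      using Suc.IH[of l] Suc by (simp add: algebra_simps)
    then show ?thesis using 1 Suc by (simp add: add_divide_distrib)
  qed
qed

lemma central_binomial_Suc:
  "Suc k * (2 * Suc k choose Suc k) = 2 * (2 * k + 1) * (2 * k choose k)"
proof -
  have "Suc k * (Suc (Suc (2 * k)) choose Suc k) = (2 * k + 2) * (Suc (2 * k) choose k)"
    using Suc_times_binomial_eq[of "Suc (2 * k)" k] by simp
  moreover have "Suc k * (Suc (2 * k) choose k) = (2 * k + 1) * (2 * k choose k)"
    using Suc_times_binomial_eq[of "2 * k" k] binomial_symmetric[of k "Suc (2 * k)"] by simp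
  ultimately have "Suc k * (Suc k * (2 * Suc k choose Suc k)) = Suc k * (2 * (2 * k + 1) * (2 * k choose k))"
    by (simp add: algebra_simps)
  then show ?thesis by (metis mult_left_cancel nat.distinct(1))
qed

text \<open>For \<open>m = 2 k\<close> this is the bound \<open>1 / sqrt (2 k + 1)\<close> on \<open>c k = (2 k choose k) / 4 ^ k\<close>: by the recursion
of the central binomial coefficients the quantity \<open>(c k)\<^sup>2 * (2 k + 1)\<close> decreases, as
\<open>(2 k + 1) * (2 k + 3) \<le> (2 k + 2)\<^sup>2\<close>. The form with \<open>m + 1\<close> is valid at \<open>m = 0\<close> as well.\<close>

lemma hit0_origin_le: "hit0 m 0 \<le> 1 / sqrt (real m + 1)"
proof (cases "even m")
  case True
  then obtain k where m: "m = 2 * k" by blast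
  define c where "c k = real (2 * k choose k) / 4 ^ k" for k :: nat
  have step: "c (Suc k) = c k * (2 * real k + 1) / (2 * real k + 2)" for k
  proof -
    have "real (Suc k * (2 * Suc k choose Suc k)) = real (2 * (2 * k + 1) * (2 * k choose k))"
      by (simp only: central_binomial_Suc)
    then have *: "real (2 * Suc k choose Suc k) = 2 * (2 * real k + 1) * real (2 * k choose k) / (real k + 1)"
      by (simp add: field_simps del: mult_Suc_right binomial_Suc_Suc)
    show ?thesis unfolding c_def * by (simp add: divide_simps) (simp add: algebra_simps)
  qed
  have "(c k)\<^sup>2 * (2 * real k + 1) \<le> 1"
  proof (induction k)
    case 0
    then show ?case by (simp add: c_def)
  next
    case (Suc k)
    have "(c (Suc k))\<^sup>2 * (2 * real (Suc k) + 1) =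
        ((c k)\<^sup>2 * (2 * real k + 1)) * (((2 * real k + 1) * (2 * real k + 3)) / (2 * real k + 2)\<^sup>2)"
      by (simp add: step power2_eq_square field_simps)
    also have "\<dots> \<le> 1 * 1"
    proof (intro mult_mono Suc)
      have "(2 * real k + 1) * (2 * real k + 3) \<le> (2 * real k + 2)\<^sup>2"
        by (simp add: power2_eq_square algebra_simps)
      then show "(2 * real k + 1) * (2 * real k + 3) / (2 * real k + 2)\<^sup>2 \<le> 1"
        by (intro divide_le_eq_1_pos[THEN iffD2]) auto
    qed auto
    finally show ?case by simp
  qed
  moreover have "hit0 m 0 = c k"
    using hit0_binomial[of m k] by (simp add: m c_def power_mult)
  ultimately have "(hit0 m 0)\<^sup>2 \<le> (1 / sqrt (real m + 1))\<^sup>2"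
    by (simp add: m power_divide field_simps)
  then show ?thesis by (rule power2_le_imp_le) simp
qed (simp add: hit0_eq_0)

lemma hit0_origin_le_1: "hit0 m 0 \<le> 1"
  by (rule order_trans[OF hit0_origin_le]) simp

section \<open>Cancellation of the signs at every site\<close>

text \<open>The positions from which the steps \<open>xs\<close> of a walk started at \<open>a\<close> are taken; the final position is left
out, because the \<open>k\<close>-th sign of the second coordinate is weighted by the position before step \<open>k\<close>.\<close>

primrec sites :: "int \<Rightarrow> int list \<Rightarrow> int list" where
  "sites a [] = []"
| "sites a (x # xs) = a # sites (a + x) xs"

lemma length_sites [simp]: "length (sites a xs) = length xs"
  by (induction xs arbitrary: a) auto

lemma sites_append: "sites a (xs @ ys) = sites a xs @ sites (a + sum_list xs) ys"
  by (induction xs arbitrary: a) (auto simp: algebra_simps)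

lemma sites_nth: "k < length xs \<Longrightarrow> sites a xs ! k = a + (\<Sum>i<k. xs ! i)"
proof (induction xs arbitrary: a k)
  case (Cons x xs)
  then show ?case by (cases k) (auto simp: sum.lessThan_Suc_shift simp del: sum.lessThan_Suc)
qed simp

text \<open>The total sign collected at \<open>j\<close>, which is the coefficient of \<open>t powi j\<close> in \<open>\<Sum>k. ys ! k * t powi (ss ! k)\<close>.\<close>

definition charge :: "int list \<Rightarrow> int list \<Rightarrow> int \<Rightarrow> int" where
  "charge ss ys j = (\<Sum>k<length ss. if ss ! k = j then ys ! k else 0)"

lemma charge_Cons: "charge (s # ss) (y # ys) j = (if s = j then y else 0) + charge ss ys j"
  by (simp add: charge_def sum.lessThan_Suc_shift del: sum.lessThan_Suc cong: if_cong)

text \<open>Different sites receive disjoint groups of signs, so the events are independent, and the sign collected at \<open>j\<close> is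
a simple walk run for as many steps as there are visits to \<open>j\<close>. The offsets \<open>a\<close> let the induction
absorb the first sign.\<close>

lemma neutral_prob:
  assumes "finite J" "set ss \<subseteq> J"
  shows "sign_avg (length ss) (\<lambda>ys. of_bool (\<forall>j\<in>J. a j + charge ss ys j = 0)) =
    (\<Prod>j\<in>J. hit0 (count_list ss j) (a j))"
  using assms(2)
proof (induction ss arbitrary: a)
  case Nil
  have "of_bool (\<forall>j\<in>J. a j = 0) = (\<Prod>j\<in>J. of_bool (a j = 0) :: real)"
    using assms(1) by (induction J) auto
  then show ?case by (simp add: charge_def)
next
  case (Cons s ss)
  define P where "P = (\<Prod>j\<in>J - {s}. hit0 (count_list (s # ss) j) (a j))"
  have *: "sign_avg (length ss) (\<lambda>ys. of_bool (\<forall>j\<in>J. a j + charge (s # ss) (y # ys) j = 0)) =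
      hit0 (count_list ss s) (a s + y) * P" for y
  proof -
    have "sign_avg (length ss) (\<lambda>ys. of_bool (\<forall>j\<in>J. a j + charge (s # ss) (y # ys) j = 0)) =
        sign_avg (length ss) (\<lambda>ys. of_bool (\<forall>j\<in>J. (a(s := a s + y)) j + charge ss ys j = 0))"
      by (intro arg_cong[of _ _ "sign_avg (length ss)"] ext arg_cong[of _ _ of_bool] ball_cong)
         (auto simp: charge_Cons)
    also have "\<dots> = (\<Prod>j\<in>J. hit0 (count_list ss j) ((a(s := a s + y)) j))"
      using Cons by simp
    also have "\<dots> = hit0 (count_list ss s) (a s + y) * P"
      unfolding P_def using Cons.prems assms(1)
      by (subst prod.remove[of _ s]) (auto intro!: prod.cong)
    finally show ?thesis .
  qed
  have "(\<Prod>j\<in>J. hit0 (count_list (s # ss) j) (a j)) = hit0 (Suc (count_list ss s)) (a s) * P"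
    unfolding P_def using Cons.prems assms(1) by (subst prod.remove[of _ s]) auto
  then show ?case by (simp add: *[of 1] *[of "-1", simplified] distrib_right add_divide_distrib)
qed

text \<open>Multiplying by \<open>t ^ N\<close> removes the negative exponents; what results is an integer polynomial with root
\<open>t\<close>, hence the zero polynomial, and its coefficients are the charges.\<close>

lemma transcendental_imp_charge_eq_0:
  fixes t :: real
  assumes "\<not> algebraic t" "t > 0" and bd: "\<And>s. s \<in> set ss \<Longrightarrow> - int N \<le> s"
    and eq: "(\<Sum>k<length ss. of_int (ys ! k) * t powi (ss ! k)) = 0"
  shows "charge ss ys j = 0"
proof (cases "- int N \<le> j")
  case True
  define p where "p = (\<Sum>k<length ss. monom (of_int (ys ! k) :: real) (nat (ss ! k + int N)))"
  have bd': "- int N \<le> ss ! k" if "k < length ss" for k using that bd by simp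
  have "poly p t = (\<Sum>k<length ss. of_int (ys ! k) * t powi (ss ! k)) * t ^ N"
    unfolding p_def poly_sum sum_distrib_right
  proof (rule sum.cong)
    fix k assume k: "k \<in> {..<length ss}"
    have "t ^ nat (ss ! k + int N) = t powi (ss ! k + int N)"
      using bd'[of k] k by (simp add: power_int_def)
    also have "\<dots> = t powi (ss ! k) * t ^ N"
      using assms(2) by (simp add: power_int_add)
    finally show "poly (monom (of_int (ys ! k)) (nat (ss ! k + int N))) t =
        of_int (ys ! k) * t powi (ss ! k) * t ^ N"
      by (simp add: poly_monom)
  qed simp
  then have root: "poly p t = 0" using eq by simp
  have coeff: "coeff p i = of_int (\<Sum>k<length ss. if nat (ss ! k + int N) = i then ys ! k else 0)" for i
    unfolding p_def coeff_sum of_int_sum by (rule sum.cong) auto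
  have "p = 0"
    using root assms(1) algebraicI[of p t] coeff by (metis Ints_of_int)
  then have "(\<Sum>k<length ss. if nat (ss ! k + int N) = nat (j + int N) then ys ! k else 0) = 0"
    using coeff[of "nat (j + int N)"] by (metis coeff_0 of_int_eq_0_iff)
  moreover have "(\<Sum>k<length ss. if nat (ss ! k + int N) = nat (j + int N) then ys ! k else 0) = charge ss ys j"
    unfolding charge_def using bd' True by (intro sum.cong if_cong) fastforce+
  ultimately show ?thesis by simp
next
  case False
  then have "ss ! k \<noteq> j" if "k < length ss" for k
    using that bd by (metis nth_mem)
  then show ?thesis by (auto simp: charge_def)
qed

section \<open>Heavily visited sites\<close>

text \<open>Requiring visited sites keeps the set finite also for the threshold \<open>m = 0\<close>, which arises for small blocks.\<close>

definition heavy :: "nat \<Rightarrow> int list \<Rightarrow> int set" where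
  "heavy m ss = {j \<in> set ss. m \<le> count_list ss j}"

lemma finite_heavy [simp]: "finite (heavy m ss)"
  by (simp add: heavy_def)

text \<open>Sites below the threshold contribute factors at most 1 to the product of return probabilities.\<close>

lemma cancel_prob_le:
  fixes t :: real
  assumes "\<not> algebraic t" "t > 0"
  shows "sign_avg (length ss) (\<lambda>ys. of_bool ((\<Sum>k<length ss. of_int (ys ! k) * t powi (ss ! k)) = 0))
    \<le> (1 / sqrt (real m + 1)) ^ card (heavy m ss)"
proof -
  define N where "N = nat (\<Sum>s\<in>set ss. \<bar>s\<bar>)"
  have bd: "- int N \<le> s" if "s \<in> set ss" for s
  proof -
    have "\<bar>s\<bar> \<le> (\<Sum>s\<in>set ss. \<bar>s\<bar>)" using that by (intro member_le_sum) auto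
    then show ?thesis by (simp add: N_def)
  qed
  have "sign_avg (length ss) (\<lambda>ys. of_bool ((\<Sum>k<length ss. of_int (ys ! k) * t powi (ss ! k)) = 0))
      \<le> sign_avg (length ss) (\<lambda>ys. of_bool (\<forall>j\<in>set ss. 0 + charge ss ys j = 0))"
    using transcendental_imp_charge_eq_0[OF assms bd] by (intro sign_avg_mono) auto
  also have "\<dots> = (\<Prod>j\<in>set ss. hit0 (count_list ss j) 0)"
    by (rule neutral_prob) auto
  also have "\<dots> = (\<Prod>j\<in>set ss - heavy m ss. hit0 (count_list ss j) 0) * (\<Prod>j\<in>heavy m ss. hit0 (count_list ss j) 0)"
    by (rule prod.subset_diff) (auto simp: heavy_def)
  also have "\<dots> \<le> 1 * (\<Prod>j\<in>heavy m ss. 1 / sqrt (real m + 1))"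
  proof (intro mult_mono prod_le_1 prod_mono prod_nonneg conjI hit0_nonneg hit0_origin_le_1)
    fix j assume "j \<in> heavy m ss"
    then have "1 / sqrt (real (count_list ss j) + 1) \<le> 1 / sqrt (real m + 1)"
      by (simp add: heavy_def frac_le)
    then show "hit0 (count_list ss j) 0 \<le> 1 / sqrt (real m + 1)"
      using hit0_origin_le order_trans by blast
  qed auto
  finally show ?thesis by simp
qed


text \<open>Summation of \<open>E (S k - b)\<^sup>2 = (a - b)\<^sup>2 + k\<close> over \<open>k < n\<close>. Keeping \<open>b\<close> apart from the starting
point \<open>a\<close> is what makes the induction work, as the first step moves only \<open>a\<close>.\<close>

lemma avg_square_displacement:
  "sign_avg n (\<lambda>xs. \<Sum>s\<leftarrow>sites a xs. (real_of_int (s - b))\<^sup>2) =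
    real n * (real_of_int (a - b))\<^sup>2 + real n * (real n - 1) / 2"
proof (induction n arbitrary: a)
  case (Suc n)
  show ?case
    by (simp add: sign_avg_add sign_avg_const Suc del: of_int_diff)
       (simp add: power2_eq_square field_simps)
qed simp

lemma avg_visits:
  "sign_avg n (\<lambda>xs. real (count_list (sites a xs) j)) = (\<Sum>k<n. hit0 k (a - j))"
proof (induction n arbitrary: a)
  case (Suc n)
  have "sign_avg n (\<lambda>xs. real (count_list (a # sites (a + y) xs) j)) =
      of_bool (a = j) + (\<Sum>k<n. hit0 k (a + y - j))" for y
  proof -
    have "sign_avg n (\<lambda>xs. real (count_list (a # sites (a + y) xs) j)) =
        sign_avg n (\<lambda>xs. of_bool (a = j) + real (count_list (sites (a + y) xs) j))"
      by (intro arg_cong[of _ _ "sign_avg n"] ext) simp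
    then show ?thesis by (simp only: sign_avg_add sign_avg_const Suc)
  qed
  note * = this
  show ?case
    by (simp only: sign_avg.simps sites.simps * sum.lessThan_Suc_shift hit0.simps
          sum_divide_distrib[symmetric] sum.distrib)
       (simp add: algebra_simps add_divide_distrib)
qed simp

text \<open>This counts the ordered pairs of times at which the walk is at the same site, which is what makes its
expectation computable.\<close>

definition collisions :: "int list \<Rightarrow> real" where
  "collisions ss = (\<Sum>j\<in>set ss. (real (count_list ss j))\<^sup>2)"

lemma collisions_Cons: "collisions (s # ss) = collisions ss + (2 * real (count_list ss s) + 1)"
proof -
  let ?J = "insert s (set ss)"
  have 1: "collisions ss = (\<Sum>j\<in>?J. (real (count_list ss j))\<^sup>2)"
    unfolding collisions_def by (rule sum.mono_neutral_left) (auto simp: count_list_0_iff)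
  have "collisions (s # ss) = (\<Sum>j\<in>?J. (real (count_list ss j))\<^sup>2 +
      (if j = s then 2 * real (count_list ss s) + 1 else 0))"
    unfolding collisions_def by (rule sum.cong) (auto simp: power2_eq_square algebra_simps)
  also have "\<dots> = collisions ss + (2 * real (count_list ss s) + 1)"
    by (simp add: sum.distrib 1 sum.delta)
  finally show ?thesis .
qed

lemma sum_inverse_sqrt_le: "(\<Sum>k<n. 1 / sqrt (real k + 2)) \<le> 2 * sqrt (real n + 1) - 2"
proof (induction n)
  case (Suc n)
  define x y where "x = sqrt (real n + 1)" and "y = sqrt (real n + 2)"
  have xy: "x > 0" "y > 0" "y * y = x * x + 1" "x \<le> y" by (auto simp: x_def y_def)
  have "1 = (y - x) * (y + x)" using xy by (simp add: algebra_simps)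
  also have "\<dots> \<le> (y - x) * (2 * y)" using xy by (intro mult_left_mono) auto
  finally have "1 / y \<le> 2 * y - 2 * x" using xy by (simp add: field_simps)
  with Suc show ?case by (simp add: x_def y_def add.commute)
qed simp

text \<open>Prepending one step at \<open>a\<close> creates one new collision and two for every later visit to \<open>a\<close>. These later
visits have expectation \<open>\<Sum>k<n. hit0 (Suc k) 0\<close>, which is of order \<open>sqrt n\<close>.\<close>

lemma avg_collisions: "sign_avg n (\<lambda>xs. collisions (sites a xs)) \<le> 4 * real n * sqrt (real n)"
proof (induction n arbitrary: a)
  case 0
  show ?case by (simp add: collisions_def)
next
  case (Suc n)
  have step: "sign_avg n (\<lambda>xs. collisions (sites a (y # xs))) \<le>
      4 * real n * sqrt (real n) + (2 * (\<Sum>k<n. hit0 k y) + 1)" for y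
  proof -
    have "sign_avg n (\<lambda>xs. collisions (sites a (y # xs))) =
        sign_avg n (\<lambda>xs. collisions (sites (a + y) xs)) + (2 * (\<Sum>k<n. hit0 k y) + 1)"
      by (simp add: collisions_Cons sign_avg_add sign_avg_mult sign_avg_const avg_visits)
    then show ?thesis using Suc[of "a + y"] by simp
  qed
  have "(\<Sum>k<n. hit0 k 1) + (\<Sum>k<n. hit0 k (-1)) = 2 * (\<Sum>k<n. hit0 (Suc k) 0)"
    by (simp add: sum.distrib[symmetric] sum_divide_distrib[symmetric])
  also have "\<dots> \<le> 2 * (\<Sum>k<n. 1 / sqrt (real k + 2))"
    using hit0_origin_le[of "Suc _"] by (intro mult_left_mono sum_mono) (auto simp: algebra_simps simp del: hit0.simps)
  also have "\<dots> \<le> 2 * (2 * sqrt (real n + 1) - 2)"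
    by (intro mult_left_mono sum_inverse_sqrt_le) simp
  finally have "sign_avg (Suc n) (\<lambda>xs. collisions (sites a xs)) \<le>
      4 * real n * sqrt (real n) + 4 * sqrt (real n + 1)"
    using step[of 1] step[of "-1"] by simp
  also have "\<dots> \<le> 4 * real n * sqrt (real n + 1) + 4 * sqrt (real n + 1)"
    by (intro add_right_mono mult_left_mono) auto
  finally show ?case by (simp add: algebra_simps)
qed

text \<open>A single nonnegative functional that is large if the walk strays much further than \<open>u\<close> from \<open>a\<close> or
concentrates on much fewer than \<open>u\<close> sites, so that one application of Markov's inequality excludes both. Its
two weights are chosen so that, for \<open>u\<^sup>2\<close> steps, both terms have expectation of order \<open>u\<^sup>2\<close>.\<close>

definition spread :: "nat \<Rightarrow> int \<Rightarrow> int list \<Rightarrow> real" where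
  "spread u a ss = (\<Sum>s\<leftarrow>ss. (real_of_int (s - a))\<^sup>2) / (4 * (real u)\<^sup>2) + collisions ss / (128 * real u)"

lemma sum_list_eq_sum_count:
  fixes f :: "'a \<Rightarrow> real"
  shows "(\<Sum>s\<leftarrow>ss. f s) = (\<Sum>j\<in>set ss. real (count_list ss j) * f j)"
proof -
  have "(\<Sum>s\<leftarrow>ss. f s) = (\<Sum>j\<in>J. real (count_list ss j) * f j)" if "finite J" "set ss \<subseteq> J" for J
    using that(2)
  proof (induction ss)
    case (Cons s ss)
    have "(\<Sum>j\<in>J. real (count_list (s # ss) j) * f j) =
        (\<Sum>j\<in>J. (if j = s then f s else 0) + real (count_list ss j) * f j)"
      by (rule sum.cong) (auto simp: algebra_simps)
    then show ?case using Cons that(1) by (simp add: sum.distrib sum.delta)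
  qed simp
  then show ?thesis by simp
qed

text \<open>Each of the \<open>u\<^sup>2\<close> visits is charged to one of three causes. Visits to light sites within distance
\<open>2 u\<close> number at most \<open>u / 20 * (4 u + 1) \<le> u\<^sup>2 / 4\<close>; each visit beyond distance \<open>2 u\<close> is dominated by
its squared displacement divided by \<open>4 u\<^sup>2\<close>; and the visits to a heavy site are split by
\<open>L \<le> L\<^sup>2 / (128 u) + 32 u\<close> between the collisions and a cost of \<open>32 u\<close> per heavy site. Fewer than \<open>u / 256\<close> heavy
sites pay for less than \<open>u\<^sup>2 / 8\<close>, so the spread must account for the remaining \<open>5 / 8 * u\<^sup>2\<close> visits.\<close>

lemma spread_ge_if_few_heavy:
  assumes len: "length ss = u\<^sup>2" and "u \<ge> 1" and few: "real (card (heavy (u div 20) ss)) < real u / 256"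
  shows "5 / 8 * (real u)\<^sup>2 \<le> spread u a ss"
proof -
  define m where "m = u div 20"
  define L where "L j = real (count_list ss j)" for j
  define near where "near = {j \<in> set ss. \<bar>j - a\<bar> \<le> 2 * int u}"
  have u: "real u > 0" using assms(2) by simp
  have ptw: "L j \<le> (if j \<in> near then real m else 0) + L j * (real_of_int (j - a))\<^sup>2 / (4 * (real u)\<^sup>2)
      + (L j)\<^sup>2 / (128 * real u) + (if j \<in> heavy m ss then 32 * real u else 0)"
    if j: "j \<in> set ss" for j
  proof -
    have nonneg: "0 \<le> (if j \<in> near then real m else 0)"
      "0 \<le> L j * (real_of_int (j - a))\<^sup>2 / (4 * (real u)\<^sup>2)" "0 \<le> (L j)\<^sup>2 / (128 * real u)"
      by (auto simp: L_def)
    consider "j \<in> heavy m ss" | "j \<notin> heavy m ss" "j \<in> near" | "j \<notin> heavy m ss" "j \<notin> near" by blast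
    then show ?thesis
    proof cases
      case 1
      have "0 \<le> (L j - 64 * real u)\<^sup>2 / (128 * real u)" by simp
      also have "\<dots> = (L j)\<^sup>2 / (128 * real u) + 32 * real u - L j"
        using u by (simp add: power2_eq_square field_simps)
      finally show ?thesis using 1 nonneg by simp
    next
      case 2
      then have "L j \<le> real m" using j by (auto simp: heavy_def L_def)
      then show ?thesis using 2 nonneg(2,3) by (simp only: if_P if_not_P if_False)
    next
      case 3
      then have "2 * int u \<le> \<bar>j - a\<bar>" using j by (auto simp: near_def)
      then have "2 * real u \<le> real_of_int \<bar>j - a\<bar>" by linarith
      then have "(2 * real u)\<^sup>2 \<le> (real_of_int \<bar>j - a\<bar>)\<^sup>2" by (intro power_mono) auto
      then have "1 \<le> (real_of_int (j - a))\<^sup>2 / (4 * (real u)\<^sup>2)"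
        using u by (simp add: power2_eq_square field_simps)
      then have "L j * 1 \<le> L j * ((real_of_int (j - a))\<^sup>2 / (4 * (real u)\<^sup>2))"
        by (intro mult_left_mono) (auto simp: L_def)
      then show ?thesis using 3 nonneg(3)
        by (simp only: if_not_P if_False mult_1_right times_divide_eq_right; linarith)
    qed
  qed
  have card_near: "real (card near) \<le> 4 * real u + 1"
  proof -
    have "near \<subseteq> {a - 2 * int u..a + 2 * int u}" by (auto simp: near_def)
    then have "card near \<le> card {a - 2 * int u..a + 2 * int u}" by (intro card_mono) auto
    then have "card near \<le> 4 * u + 1" by simp
    then show ?thesis by linarith
  qed
  have "real m * real (card near) \<le> real u / 20 * (5 * real u)"
  proof (intro mult_mono)
    have "real (20 * m) \<le> real u" unfolding m_def of_nat_le_iff by simp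
    then show "real m \<le> real u / 20" by simp
    show "real (card near) \<le> 5 * real u" using card_near assms(2) by simp
  qed auto
  then have light: "real m * real (card near) \<le> (real u)\<^sup>2 / 4" by (simp add: power2_eq_square)
  have "32 * real u * real (card (heavy m ss)) \<le> 32 * real u * (real u / 256)"
    using few u unfolding m_def by (intro mult_left_mono) auto
  then have hv: "32 * real u * real (card (heavy m ss)) \<le> (real u)\<^sup>2 / 8" by (simp add: power2_eq_square)
  have inter: "set ss \<inter> near = near" "set ss \<inter> heavy m ss = heavy m ss"
    by (auto simp: near_def heavy_def)
  have "(real u)\<^sup>2 = (\<Sum>s\<leftarrow>ss. 1)" using len by (simp add: sum_list_triv)
  also have "\<dots> = (\<Sum>j\<in>set ss. L j)" by (simp only: sum_list_eq_sum_count L_def) simp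
  also have "\<dots> \<le> (\<Sum>j\<in>set ss. (if j \<in> near then real m else 0)
      + L j * (real_of_int (j - a))\<^sup>2 / (4 * (real u)\<^sup>2)
      + (L j)\<^sup>2 / (128 * real u) + (if j \<in> heavy m ss then 32 * real u else 0))"
    by (rule sum_mono) (rule ptw)
  also have "\<dots> = real m * real (card near) + spread u a ss + 32 * real u * real (card (heavy m ss))"
    by (simp add: sum.distrib sum.If_cases inter spread_def collisions_def L_def
        sum_list_eq_sum_count sum_divide_distrib)
  finally show ?thesis using light hv by simp
qed

text \<open>Markov's inequality: the mean spread over \<open>u\<^sup>2\<close> steps is at most \<open>u\<^sup>2 / 8 + u\<^sup>2 / 32 = 5 / 32 * u\<^sup>2\<close>, a
quarter of the value forced by having few heavy sites.\<close>

lemma block_few_heavy_prob: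
  assumes "u \<ge> 1"
  shows "sign_avg (u\<^sup>2) (\<lambda>xs. of_bool (real (card (heavy (u div 20) (sites a xs))) < real u / 256)) \<le> 1 / 4"
proof -
  have u: "real u > 0" using assms by simp
  define C where "C = 8 / (5 * (real u)\<^sup>2)"
  have C: "C > 0" using u by (simp add: C_def)
  have "sign_avg (u\<^sup>2) (\<lambda>xs. of_bool (real (card (heavy (u div 20) (sites a xs))) < real u / 256))
      \<le> sign_avg (u\<^sup>2) (\<lambda>xs. C * spread u a (sites a xs))"
  proof (rule sign_avg_mono)
    fix xs :: "int list" assume len: "length xs = u\<^sup>2"
    have nn: "0 \<le> spread u a (sites a xs)"
      unfolding spread_def collisions_def
      by (intro add_nonneg_nonneg divide_nonneg_nonneg sum_list_nonneg sum_nonneg) auto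
    show "of_bool (real (card (heavy (u div 20) (sites a xs))) < real u / 256) \<le> C * spread u a (sites a xs)"
    proof (cases "real (card (heavy (u div 20) (sites a xs))) < real u / 256")
      case True
      then have "5 / 8 * (real u)\<^sup>2 \<le> spread u a (sites a xs)"
        using spread_ge_if_few_heavy len assms by simp
      then have "C * (5 / 8 * (real u)\<^sup>2) \<le> C * spread u a (sites a xs)"
        using C by (intro mult_left_mono) auto
      then show ?thesis using True u by (simp add: C_def)
    qed (use C nn in simp)
  qed
  also have "\<dots> = C * sign_avg (u\<^sup>2) (\<lambda>xs. 1 / (4 * (real u)\<^sup>2) * (\<Sum>s\<leftarrow>sites a xs. (real_of_int (s - a))\<^sup>2) +
      1 / (128 * real u) * collisions (sites a xs))"
    by (simp add: sign_avg_mult spread_def)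
  also have "\<dots> = C * (1 / (4 * (real u)\<^sup>2) * (real (u\<^sup>2) * (real (u\<^sup>2) - 1) / 2) +
      1 / (128 * real u) * sign_avg (u\<^sup>2) (\<lambda>xs. collisions (sites a xs)))"
    by (simp only: sign_avg_add sign_avg_mult avg_square_displacement) simp
  also have "\<dots> \<le> C * (1 / (4 * (real u)\<^sup>2) * (real (u\<^sup>2) * real (u\<^sup>2) / 2) +
      1 / (128 * real u) * (4 * real (u\<^sup>2) * sqrt (real (u\<^sup>2))))"
    using C by (intro mult_left_mono add_mono divide_right_mono avg_collisions) auto
  also have "\<dots> = 1 / 4"
    using u by (simp add: C_def power2_eq_square field_simps)
  finally show ?thesis .
qed

lemma heavy_append: "heavy m ss \<subseteq> heavy m (ss @ ts)" "heavy m ts \<subseteq> heavy m (ss @ ts)"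
  by (auto simp: heavy_def)

text \<open>Concatenation can only increase the number of visits, so the whole walk has few heavy sites only if
each of its \<open>B\<close> disjoint blocks does. The bound for one block does not depend on the starting
point of a block, so the probabilities multiply.\<close>

lemma few_heavy_prob:
  assumes "u \<ge> 1"
  shows "sign_avg (B * u\<^sup>2 + r) (\<lambda>xs. of_bool (real (card (heavy (u div 20) (sites a xs))) < real u / 256))
    \<le> (1 / 4) ^ B"
proof (induction B arbitrary: a)
  case 0
  have "sign_avg r (\<lambda>xs. of_bool (real (card (heavy (u div 20) (sites a xs))) < real u / 256))
      \<le> sign_avg r (\<lambda>_. 1)" by (rule sign_avg_mono) simp
  then show ?case by (simp add: sign_avg_const)
next
  case (Suc B)
  define few where "few a xs \<longleftrightarrow> real (card (heavy (u div 20) (sites a xs))) < real u / 256" for a xs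
  have few_append: "few a xs \<and> few (a + sum_list xs) ys" if "few a (xs @ ys)" for xs ys
  proof -
    have "card (heavy (u div 20) (sites a xs)) \<le> card (heavy (u div 20) (sites a (xs @ ys)))"
      "card (heavy (u div 20) (sites (a + sum_list xs) ys)) \<le> card (heavy (u div 20) (sites a (xs @ ys)))"
      by (auto simp: sites_append intro!: card_mono heavy_append)
    then show ?thesis using that unfolding few_def by linarith
  qed
  have "sign_avg (Suc B * u\<^sup>2 + r) (\<lambda>xs. of_bool (few a xs)) =
      sign_avg (u\<^sup>2) (\<lambda>xs. sign_avg (B * u\<^sup>2 + r) (\<lambda>ys. of_bool (few a (xs @ ys))))"
    by (simp only: mult_Suc add.assoc sign_avg_append)
  also have "\<dots> \<le> sign_avg (u\<^sup>2) (\<lambda>xs. (1 / 4) ^ B * of_bool (few a xs))"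
  proof (rule sign_avg_mono)
    fix xs :: "int list"
    have "sign_avg (B * u\<^sup>2 + r) (\<lambda>ys. of_bool (few a (xs @ ys)))
        \<le> sign_avg (B * u\<^sup>2 + r) (\<lambda>ys. of_bool (few a xs) * of_bool (few (a + sum_list xs) ys))"
      using few_append[of xs] by (intro sign_avg_mono) auto
    also have "\<dots> = of_bool (few a xs) * sign_avg (B * u\<^sup>2 + r) (\<lambda>ys. of_bool (few (a + sum_list xs) ys))"
      by (rule sign_avg_mult)
    also have "\<dots> \<le> of_bool (few a xs) * (1 / 4) ^ B"
      unfolding few_def by (intro mult_left_mono Suc) simp
    finally show "sign_avg (B * u\<^sup>2 + r) (\<lambda>ys. of_bool (few a (xs @ ys))) \<le> (1 / 4) ^ B * of_bool (few a xs)"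
      by (simp add: mult.commute)
  qed
  also have "\<dots> = (1 / 4) ^ B * sign_avg (u\<^sup>2) (\<lambda>xs. of_bool (few a xs))"
    by (rule sign_avg_mult)
  also have "\<dots> \<le> (1 / 4) ^ B * (1 / 4)"
    unfolding few_def by (intro mult_left_mono block_few_heavy_prob assms) simp
  finally show ?case by (simp add: few_def)
qed

text \<open>Either the walk has fewer than \<open>u / 256\<close> heavy sites, or the signs must cancel at no fewer than \<open>u / 256\<close> sites with at
least \<open>u div 20\<close> visits each.\<close>

lemma cancel_prob_walk_le:
  fixes t :: real
  assumes "\<not> algebraic t" "t > 0" "u \<ge> 1"
  shows "sign_avg N (\<lambda>xs. sign_avg N (\<lambda>ys. of_bool ((\<Sum>k<N. of_int (ys ! k) * t powi (sites 0 xs ! k)) = 0)))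
    \<le> (1 / 4) ^ (N div u\<^sup>2) + exp (- (real u / 512) * ln (real u / 20))"
proof -
  define m where "m = u div 20"
  define few where "few xs \<longleftrightarrow> real (card (heavy m (sites 0 xs))) < real u / 256" for xs
  define \<rho> where "\<rho> = exp (- (real u / 512) * ln (real u / 20))"
  define P where "P xs = sign_avg N (\<lambda>ys. of_bool ((\<Sum>k<N. of_int (ys ! k) * t powi (sites 0 xs ! k)) = 0))" for xs
  have \<rho>: "(1 / sqrt (real m + 1)) ^ k \<le> \<rho>" if "real u / 256 \<le> real k" for k
  proof -
    have "u < 20 * (m + 1)" unfolding m_def using dividend_less_times_div[of 20 u] by simp
    then have "real u < real (20 * (m + 1))" by (simp only: of_nat_less_iff)
    then have "real u / 20 \<le> real m + 1" by simp
    then have ln_le: "ln (real u / 20) \<le> ln (real m + 1)" using assms(3) by (subst ln_le_cancel_iff) auto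
    \<comment> \<open>Here \<open>1 / 512\<close> is half of \<open>1 / 256\<close>: the square root halves the exponent.\<close>
    have "(1 / sqrt (real m + 1)) ^ k = exp (real k * (- ln (real m + 1) / 2))"
      by (subst exp_of_nat_mult) (simp add: exp_minus inverse_eq_divide ln_sqrt[symmetric])
    also have "\<dots> = exp (- (real k / 2) * ln (real m + 1))" by simp
    also have "\<dots> \<le> exp (- (real u / 512) * ln (real m + 1))"
      using that by (intro exp_le_cancel_iff[THEN iffD2] mult_right_mono) auto
    also have "\<dots> \<le> \<rho>"
      unfolding \<rho>_def using ln_le by (intro exp_le_cancel_iff[THEN iffD2] mult_left_mono_neg) auto
    finally show ?thesis .
  qed
  have "sign_avg N P \<le> sign_avg N (\<lambda>xs. of_bool (few xs) + \<rho>)"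
  proof (rule sign_avg_mono)
    fix xs :: "int list" assume len: "length xs = N"
    show "P xs \<le> of_bool (few xs) + \<rho>"
    proof (cases "few xs")
      case True
      have "P xs \<le> sign_avg N (\<lambda>_. 1)" unfolding P_def by (rule sign_avg_mono) simp
      then show ?thesis using True by (simp add: sign_avg_const \<rho>_def add_increasing2)
    next
      case False
      have "P xs \<le> (1 / sqrt (real m + 1)) ^ card (heavy m (sites 0 xs))"
        unfolding P_def using cancel_prob_le[OF assms(1,2), of "sites 0 xs" m] len by simp
      also have "\<dots> \<le> \<rho>" using False by (intro \<rho>) (simp add: few_def)
      finally show ?thesis using False by simp
    qed
  qed
  also have "\<dots> = sign_avg (N div u\<^sup>2 * u\<^sup>2 + N mod u\<^sup>2) (\<lambda>xs. of_bool (few xs)) + \<rho>"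
    by (simp only: div_mult_mod_eq sign_avg_add sign_avg_const)
  also have "\<dots> \<le> (1 / 4) ^ (N div u\<^sup>2) + \<rho>"
    unfolding few_def m_def by (intro add_right_mono few_heavy_prob assms)
  finally show ?thesis unfolding P_def[abs_def] \<rho>_def .
qed

section \<open>From the random steps to averages over sign sequences\<close>

text \<open>Each sequence of the first \<open>N\<close> signs of \<open>X\<close> and \<open>Y\<close> has probability \<open>1 / 4 ^ N\<close> by independence, and almost
surely all steps are signs. For an upper bound it is enough to cover \<open>E\<close> by cylinder sets, up to a
null set.\<close>

lemma (in prob_space) steps_prob_le:
  assumes steps: "bernoulli_steps M X Y"
    and R: "\<And>\<omega> xs ys. \<lbrakk>\<omega> \<in> E; xs \<in> signs N; ys \<in> signs N;
      \<And>k. k < N \<Longrightarrow> X (Suc k) \<omega> = of_int (xs ! k) \<and> Y (Suc k) \<omega> = of_int (ys ! k)\<rbrakk> \<Longrightarrow> R xs ys"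
  shows "prob E \<le> sign_avg N (\<lambda>xs. sign_avg N (\<lambda>ys. of_bool (R xs ys)))"
proof -
  define cyl where "cyl = (\<lambda>(xs, ys). {\<omega> \<in> space M. \<forall>k<N.
    X (Suc k) \<omega> = of_int (xs ! k :: int) \<and> Y (Suc k) \<omega> = of_int (ys ! k :: int)})"
  have ind: "indep_vars (\<lambda>_. borel) (case_sum X Y) ({1..} <+> {1..})"
    using steps by (simp add: bernoulli_steps_def)
  have meas: "X (Suc k) \<in> borel_measurable M" "Y (Suc k) \<in> borel_measurable M" for k
    using ind unfolding indep_vars_def by (auto simp: Ball_def Plus_def elim!: allE[of _ "Suc k"] dest: spec[of _ "Inl (Suc k)"] spec[of _ "Inr (Suc k)"])
  note [measurable] = meas
  have half: "prob {\<omega> \<in> space M. X (Suc k) \<omega> = v} = 1 / 2" "prob {\<omega> \<in> space M. Y (Suc k) \<omega> = v} = 1 / 2"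
    if "v = 1 \<or> v = -1" for k v
    using steps that by (auto simp: bernoulli_steps_def)
  have cyl_sets: "cyl p \<in> sets M" for p
    unfolding cyl_def by (cases p) simp
  have cyl_prob: "prob (cyl (xs, ys)) = 1 / 4 ^ N" if "xs \<in> signs N" "ys \<in> signs N" for xs ys
  proof (cases "N = 0")
    case True
    then show ?thesis by (simp add: cyl_def prob_space)
  next
    case False
    define J where "J = {1..N} <+> {1..N}"
    define A where "A = case_sum (\<lambda>i. {real_of_int (xs ! (i - 1))}) (\<lambda>i. {real_of_int (ys ! (i - 1))})"
    have J_eq: "J = (\<lambda>k. Inl (Suc k)) ` {..<N} \<union> (\<lambda>k. Inr (Suc k)) ` {..<N}"
      unfolding J_def Plus_def image_Suc_lessThan[symmetric] image_image ..
    have "J \<noteq> {}" using False by (auto simp: J_def)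
    then have "cyl (xs, ys) = (\<Inter>i\<in>J. case_sum X Y i -` A i \<inter> space M)"
      using False by (auto simp: cyl_def J_eq A_def ball_Un)
    also have "prob \<dots> = (\<Prod>i\<in>J. prob (case_sum X Y i -` A i \<inter> space M))"
      using \<open>J \<noteq> {}\<close> by (intro indep_varsD[OF ind]) (auto simp: J_def A_def split: sum.split)
    also have "\<dots> = (\<Prod>i\<in>J. 1 / 2)"
    proof (rule prod.cong)
      fix i assume "i \<in> J"
      have pm: "real_of_int (zs ! k) = 1 \<or> real_of_int (zs ! k) = -1" if "zs \<in> signs N" "k < N" for zs k
      proof -
        have "zs ! k \<in> {1, -1}" using that nth_mem[of k zs] unfolding signs_def by blast
        then show ?thesis by auto
      qed
      have eq: "Z -` {c} \<inter> space M = {\<omega> \<in> space M. Z \<omega> = c}" for Z :: "'a \<Rightarrow> real" and c by auto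
      from \<open>i \<in> J\<close> obtain k where "k < N" "i = Inl (Suc k) \<or> i = Inr (Suc k)"
        by (auto simp: J_eq)
      then show "prob (case_sum X Y i -` A i \<inter> space M) = 1 / 2"
        using half pm that by (auto simp: A_def eq)
    qed simp
    also have "\<dots> = 1 / 4 ^ N"
      by (simp add: J_def card_Plus power_add power_mult_distrib[symmetric] power_one_over)
    finally show ?thesis .
  qed
  have AE_pm: "AE \<omega> in M. Z \<omega> = 1 \<or> Z \<omega> = -1"
    if Z: "Z \<in> borel_measurable M" "prob {\<omega> \<in> space M. Z \<omega> = 1} = 1 / 2"
      "prob {\<omega> \<in> space M. Z \<omega> = -1} = 1 / 2" for Z :: "'a \<Rightarrow> real"
  proof -
    note [measurable] = Z(1)
    have "prob {\<omega> \<in> space M. Z \<omega> = 1 \<or> Z \<omega> = -1} =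
        prob ({\<omega> \<in> space M. Z \<omega> = 1} \<union> {\<omega> \<in> space M. Z \<omega> = -1})"
      by (intro arg_cong[of _ _ prob]) auto
    also have "\<dots> = 1" using Z by (subst finite_measure_Union) auto
    finally show ?thesis by (subst prob_Collect_eq_1[symmetric]) auto
  qed
  define P where "P = {p \<in> signs N \<times> signs N. case_prod R p}"
  have finP: "finite P" by (simp add: P_def finite_signs)
  have cover: "\<omega> \<in> (\<Union>p\<in>P. cyl p)" if "\<omega> \<in> E" "\<omega> \<in> space M"
    and pm: "\<forall>k\<in>{..<N}. (X (Suc k) \<omega> = 1 \<or> X (Suc k) \<omega> = -1) \<and> (Y (Suc k) \<omega> = 1 \<or> Y (Suc k) \<omega> = -1)" for \<omega>
  proof -
    define sg where "sg Z = map (\<lambda>k. if Z (Suc k) \<omega> = 1 then 1 else -1 :: int) [0..<N]" for Z :: "nat \<Rightarrow> 'a \<Rightarrow> real"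
    have "R (sg X) (sg Y)"
      using pm \<open>\<omega> \<in> E\<close> by (intro R) (auto simp: sg_def signs_def)
    moreover have "sg X \<in> signs N" "sg Y \<in> signs N" by (auto simp: sg_def signs_def)
    moreover have "\<omega> \<in> cyl (sg X, sg Y)"
      using pm \<open>\<omega> \<in> space M\<close> by (auto simp: cyl_def sg_def)
    ultimately show "\<omega> \<in> (\<Union>p\<in>P. cyl p)" by (auto simp: P_def)
  qed
  have "AE \<omega> in M. \<forall>k\<in>{..<N}. (X (Suc k) \<omega> = 1 \<or> X (Suc k) \<omega> = -1) \<and> (Y (Suc k) \<omega> = 1 \<or> Y (Suc k) \<omega> = -1)"
    using half by (intro AE_finite_allI AE_conjI AE_pm meas) auto
  with AE_space have "AE \<omega> in M. \<omega> \<in> E \<longrightarrow> \<omega> \<in> (\<Union>p\<in>P. cyl p)"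
    by eventually_elim (use cover in blast)
  then have "prob E \<le> prob (\<Union>p\<in>P. cyl p)"
    using finP cyl_sets by (intro finite_measure_mono_AE) auto
  also have "\<dots> \<le> (\<Sum>p\<in>P. prob (cyl p))"
    using finP cyl_sets by (intro finite_measure_subadditive_finite) auto
  also have "\<dots> = (\<Sum>p\<in>P. 1 / 4 ^ N)"
    by (rule sum.cong) (auto simp: P_def cyl_prob)
  also have "\<dots> = (\<Sum>p\<in>signs N \<times> signs N. of_bool (case_prod R p) / 4 ^ N)"
    unfolding P_def by (rule sum.mono_neutral_cong_left) (auto simp: finite_signs)
  also have "\<dots> = sign_avg N (\<lambda>xs. sign_avg N (\<lambda>ys. of_bool (R xs ys)))"
    unfolding sign_avg_eq_sum sum_divide_distrib
    by (simp add: sum.cartesian_product case_prod_beta power_mult_distrib[symmetric])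
  finally show ?thesis .
qed

section \<open>Choice of the block length\<close>

text \<open>The choice \<open>u \<approx> (n / ln n) powr (1/3)\<close> balances \<open>n / u\<^sup>2\<close> against \<open>u * ln u\<close>. The second exponent is asymptotically
\<open>- n powr (1/3) * ln n powr (2/3) / 1536\<close>, as \<open>1536 = 3 * 512\<close>; the constant 2000 leaves room for
lower order terms. Each of the two summands is bounded by half of the right-hand side, which is why
\<open>ln 2\<close> is subtracted from the exponents.\<close>

lemma block_length_tradeoff:
  "\<forall>\<^sub>F n in sequentially. \<exists>u\<ge>1. (1 / 4) ^ (2 * n div u\<^sup>2) + exp (- (real u / 512) * ln (real u / 20))
     \<le> exp (- (1 / 2000) * real n powr (1 / 3) * ln (real n) powr (2 / 3))"
proof -
  define v where "v n = (real n / ln (real n)) powr (1 / 3)" for n :: nat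
  have "\<forall>\<^sub>F n in sequentially. v n \<ge> 20" unfolding v_def by real_asymp
  moreover have "\<forall>\<^sub>F n in sequentially. 1 - 2 * real n / (v n + 1)\<^sup>2
      \<le> - (1 / 2000) * real n powr (1 / 3) * ln (real n) powr (2 / 3) - ln 2"
    unfolding v_def by real_asymp
  moreover have "\<forall>\<^sub>F n in sequentially. - (v n / 512) * ln (v n / 20)
      \<le> - (1 / 2000) * real n powr (1 / 3) * ln (real n) powr (2 / 3) - ln 2"
    unfolding v_def by real_asymp
  ultimately show ?thesis
  proof eventually_elim
    case (elim n)
    define g where "g = - (1 / 2000) * real n powr (1 / 3) * ln (real n) powr (2 / 3)"
    define u where "u = nat \<lceil>v n\<rceil>"
    have u: "v n \<le> real u" "real u \<le> v n + 1" using elim(1) unfolding u_def by linarith+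
    have u1: "real u \<ge> 20" using u elim(1) by linarith
    define B where "B = 2 * n div u\<^sup>2"
    have "2 * n < u\<^sup>2 + u\<^sup>2 * B"
      unfolding B_def using u1 by (intro dividend_less_times_div) auto
    then have "real (2 * n) < real (u\<^sup>2 + u\<^sup>2 * B)" by (simp only: of_nat_less_iff)
    then have "real (2 * n) / real (u\<^sup>2) \<le> real B + 1"
      using u1 by (simp add: divide_le_eq algebra_simps)
    moreover have "2 * real n / (v n + 1)\<^sup>2 \<le> 2 * real n / (real u)\<^sup>2"
      using u u1 by (intro divide_left_mono power_mono) auto
    ultimately have B: "2 * real n / (v n + 1)\<^sup>2 - 1 \<le> real B" by simp
    have "exp 1 \<le> (4 :: real)" using exp_le by simp
    then have "1 / 4 \<le> exp (-1 :: real)" by (simp add: exp_minus inverse_eq_divide field_simps)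
    then have "(1 / 4) ^ B \<le> exp (-1 :: real) ^ B" by (intro power_mono) auto
    also have "\<dots> = exp (- real B)" by (simp add: exp_of_nat_mult[symmetric])
    also have "\<dots> \<le> exp (1 - 2 * real n / (v n + 1)\<^sup>2)" using B by simp
    also have "\<dots> \<le> exp (g - ln 2)" using elim(2) by (simp add: g_def)
    finally have "(1 / 4) ^ B \<le> exp (g - ln 2)" .
    moreover have "v n / 512 * ln (v n / 20) \<le> real u / 512 * ln (real u / 20)"
      using u u1 elim(1) by (intro mult_mono) auto
    then have "exp (- (real u / 512) * ln (real u / 20)) \<le> exp (g - ln 2)"
      using elim(3) by (simp add: g_def)
    moreover have "exp (g - ln 2) = exp g / 2" by (simp add: exp_diff)
    ultimately have "(1 / 4) ^ B + exp (- (real u / 512) * ln (real u / 20)) \<le> exp g"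
      by linarith
    moreover have "u \<ge> 1" using u1 by linarith
    ultimately show ?case unfolding B_def g_def by blast
  qed
qed

section \<open>The return probability\<close>

theorem proposition3p2:
  fixes M :: "'w measure" and X Y :: "nat \<Rightarrow> 'w \<Rightarrow> real" and \<epsilon> :: real
  assumes "prob_space M"
    and "bernoulli_steps M X Y"
    and "\<epsilon> > 0"
    and "\<not> algebraic (exp \<epsilon>)"
  shows "(\<forall>n. return_prob M \<epsilon> X Y (2 * n) =
            measure M {\<omega> \<in> space M. walk_S X (2 * n) \<omega> = 0 \<and>
              (\<Sum>k = 1..2 * n. Y k \<omega> * exp (\<epsilon> * walk_S X (k - 1) \<omega>)) = 0}) \<and>
         (\<exists>c::real. c \<ge> 1 \<and>
            (\<forall>\<^sub>F n in sequentially.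
               return_prob M \<epsilon> X Y (2 * n) \<le>
                 exp (- (1 / c) * real n powr (1/3) * ln (real n) powr (2/3))))"
proof -
  interpret prob_space M by fact
  define E where "E N = {\<omega> \<in> space M. walk_S X N \<omega> = 0 \<and>
      (\<Sum>k = 1..N. Y k \<omega> * exp (\<epsilon> * walk_S X (k - 1) \<omega>)) = 0}" for N
  have ret: "return_prob M \<epsilon> X Y N = prob (E N)" for N
    using assms(3) by (simp add: return_prob_def E_def aff_walk_explicit aff_mat_1_0[symmetric] aff_mat_inject)
  have prob_E: "prob (E N) \<le> sign_avg N (\<lambda>xs. sign_avg N (\<lambda>ys.
      of_bool ((\<Sum>k<N. of_int (ys ! k) * exp \<epsilon> powi (sites 0 xs ! k)) = 0)))" for N
  proof (rule steps_prob_le[OF assms(2)])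
    fix \<omega> xs ys
    assume \<omega>: "\<omega> \<in> E N" and xs: "xs \<in> signs N"
      and XY: "\<And>k. k < N \<Longrightarrow> X (Suc k) \<omega> = of_int (xs ! k) \<and> Y (Suc k) \<omega> = of_int (ys ! k)"
    have "walk_S X k \<omega> = of_int (sites 0 xs ! k)" if "k < N" for k
      using that xs XY by (simp add: walk_S_def sites_nth signs_def sum.atLeast1_atMost_eq)
    then have "(\<Sum>k<N. of_int (ys ! k) * exp \<epsilon> powi (sites 0 xs ! k)) =
        (\<Sum>k<N. Y (Suc k) \<omega> * exp (\<epsilon> * walk_S X k \<omega>))"
      using XY by (intro sum.cong) (auto simp: exp_power_int mult.commute)
    also have "\<dots> = 0" using \<omega> by (simp add: E_def sum.atLeast1_atMost_eq)
    finally show "(\<Sum>k<N. of_int (ys ! k) * exp \<epsilon> powi (sites 0 xs ! k)) = 0" .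
  qed
  have "\<forall>\<^sub>F n in sequentially. return_prob M \<epsilon> X Y (2 * n) \<le>
      exp (- (1 / 2000) * real n powr (1/3) * ln (real n) powr (2/3))"
    using block_length_tradeoff
  proof eventually_elim
    case (elim n)
    then obtain u where "u \<ge> 1" and
      u: "(1 / 4) ^ (2 * n div u\<^sup>2) + exp (- (real u / 512) * ln (real u / 20))
        \<le> exp (- (1 / 2000) * real n powr (1 / 3) * ln (real n) powr (2 / 3))" by blast
    have "return_prob M \<epsilon> X Y (2 * n) \<le> (1 / 4) ^ (2 * n div u\<^sup>2) + exp (- (real u / 512) * ln (real u / 20))"
      unfolding ret using prob_E cancel_prob_walk_le[OF assms(4) _ \<open>u \<ge> 1\<close>] order_trans by fastforce
    with u show ?case by linarith
  qed
  moreover have "(2000 :: real) \<ge> 1" by simp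
  ultimately show ?thesis using ret unfolding E_def by blast
qed

end
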